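(* Let $G$ be a countably infinite group and $S \subset G$. Then $G$ admits an $S$-midpointed convex geometry if and only if $G$ admits an $S$-midpointed ordering of order type $\omega$.
   Context: Let $\mathrm{FinSet}(G)$ be the set of finite subsets of $G$. A family $\mathcal{C} \subset \mathrm{FinSet}(G)$ is a convex geometry if $\mathcal{C} = \{\tau(B) : B \in \mathrm{FinSet}(G)\}$ for a map $\tau : \mathrm{FinSet}(G) \to \mathrm{FinSet}(G)$ with $\tau(\emptyset) = \emptyset$, $B \subset \tau(B)$, $B \subset B' \implies \tau(B) \subset \tau(B')$, $\tau(\tau(B)) = \tau(B)$, and such that the anti-exchange axiom holds: if $C \in \mathcal{C}$, $y \neq z$, $C \cap \{y,z\} = \emptyset$ and $y \in \tau(C \cup \{z\})$, then $z \notin \tau(C \cup \{y\})$. For $S \subset G$, it is $S$-midpointed if $g \in \tau(\{gh, gh^{-1}\})$ for all $g \in G$ and $h \in S$. (No translation-invariance is required.) A total order $<$ on $G$ is $S$-midpointed if $g \leq \max(gh^{-1}, gh)$ for all $g \in G$ and $h \in S$. The order is not required to be translation-invariant. *)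

theory Defs
  imports "HOL-Algebra.Group" "HOL-Library.FuncSet" "HOL-Library.Countable_Set"
begin

text \<open>Only the values of \<open>\<tau>\<close> on the finite subsets of \<open>X\<close> are relevant.\<close>

definition convex_geometry_closure :: "'a set \<Rightarrow> 'a set set \<Rightarrow> ('a set \<Rightarrow> 'a set) \<Rightarrow> bool" where
  "convex_geometry_closure X \<C> \<tau> \<longleftrightarrow>
     \<tau> \<in> Fpow X \<rightarrow> Fpow X \<and>
     \<C> = \<tau> ` Fpow X \<and>
     \<tau> {} = {} \<and>
     (\<forall>B\<in>Fpow X. B \<subseteq> \<tau> B) \<and>
     (\<forall>B\<in>Fpow X. \<forall>B'\<in>Fpow X. B \<subseteq> B' \<longrightarrow> \<tau> B \<subseteq> \<tau> B') \<and>
     (\<forall>B\<in>Fpow X. \<tau> (\<tau> B) = \<tau> B) \<and>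
     (\<forall>C\<in>\<C>. \<forall>y\<in>X. \<forall>z\<in>X.
        y \<noteq> z \<and> C \<inter> {y, z} = {} \<and> y \<in> \<tau> (C \<union> {z}) \<longrightarrow> z \<notin> \<tau> (C \<union> {y}))"

definition convex_geometry :: "'a set \<Rightarrow> 'a set set \<Rightarrow> bool" where
  "convex_geometry X \<C> \<longleftrightarrow> (\<exists>\<tau>. convex_geometry_closure X \<C> \<tau>)"

text \<open>On the finite subsets of \<open>X\<close> the map \<open>\<tau>\<close> is determined by the family \<open>\<C>\<close>, so it makes
  no difference whether \<open>\<tau>\<close> is quantified existentially or universally below.\<close>

lemma convex_geometry_closure_unique:
  assumes "convex_geometry_closure X \<C> \<tau>" "convex_geometry_closure X \<C> \<sigma>" "B \<in> Fpow X"
  shows "\<tau> B = \<sigma> B"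
proof -
  have le: "t B \<subseteq> s B"
    if t: "convex_geometry_closure X \<C> t" and s: "convex_geometry_closure X \<C> s" for t s
  proof -
    have imgs: "\<C> = s ` Fpow X"
      using s unfolding convex_geometry_closure_def by (elim conjE)
    have imgt: "\<C> = t ` Fpow X"
      using t unfolding convex_geometry_closure_def by (elim conjE)
    have "s B \<in> t ` Fpow X"
      using imageI[OF assms(3), of s] unfolding imgs[symmetric] imgt[symmetric] .
    then obtain D where D: "D \<in> Fpow X" "s B = t D" by (rule imageE)
    have maps: "s \<in> Fpow X \<rightarrow> Fpow X"
      using s unfolding convex_geometry_closure_def by (elim conjE)
    have ext: "\<forall>B\<in>Fpow X. B \<subseteq> s B"
      using s unfolding convex_geometry_closure_def by (elim conjE)
    have sB: "s B \<in> Fpow X" "B \<subseteq> s B"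
      using funcset_mem[OF maps assms(3)] bspec[OF ext assms(3)] by this+
    have mono: "\<forall>B\<in>Fpow X. \<forall>B'\<in>Fpow X. B \<subseteq> B' \<longrightarrow> t B \<subseteq> t B'"
      using t unfolding convex_geometry_closure_def by (elim conjE)
    have idem: "\<forall>B\<in>Fpow X. t (t B) = t B"
      using t unfolding convex_geometry_closure_def by (elim conjE)
    have "t B \<subseteq> t (s B)"
      using mono assms(3) sB by simp
    also have "t (s B) = s B"
      using idem D by simp
    finally show ?thesis .
  qed
  show ?thesis
    using le[OF assms(1,2)] le[OF assms(2,1)] by (rule equalityI)
qed

definition midpointed_convex_geometry ::
    "('a, 'b) monoid_scheme \<Rightarrow> 'a set \<Rightarrow> 'a set set \<Rightarrow> bool" where
  "midpointed_convex_geometry G S \<C> \<longleftrightarrow>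
     (\<exists>\<tau>. convex_geometry_closure (carrier G) \<C> \<tau> \<and>
        (\<forall>g\<in>carrier G. \<forall>h\<in>S. g \<in> \<tau> {g \<otimes>\<^bsub>G\<^esub> h, g \<otimes>\<^bsub>G\<^esub> inv\<^bsub>G\<^esub> h}))"

lemma midpointed_convex_geometry_imp_convex_geometry:
  "midpointed_convex_geometry G S \<C> \<Longrightarrow> convex_geometry (carrier G) \<C>"
  unfolding midpointed_convex_geometry_def convex_geometry_def by blast

text \<open>Orders are represented by their reflexive relation: \<open>(x, y) \<in> r\<close> means \<open>x \<le> y\<close>.\<close>

definition rel_max :: "'a rel \<Rightarrow> 'a \<Rightarrow> 'a \<Rightarrow> 'a" where
  "rel_max r x y = (if (x, y) \<in> r then y else x)"

definition midpointed_order ::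
    "('a, 'b) monoid_scheme \<Rightarrow> 'a set \<Rightarrow> 'a rel \<Rightarrow> bool" where
  "midpointed_order G S r \<longleftrightarrow>
     linear_order_on (carrier G) r \<and>
     (\<forall>g\<in>carrier G. \<forall>h\<in>S. (g, rel_max r (g \<otimes>\<^bsub>G\<^esub> inv\<^bsub>G\<^esub> h) (g \<otimes>\<^bsub>G\<^esub> h)) \<in> r)"

text \<open>\<open>natLeq\<close> is the relation \<open>\<le>\<close> on the natural numbers and \<open>ordIso\<close> is isomorphism of well-orders.\<close>

definition order_type_omega :: "'a rel \<Rightarrow> bool" where
  "order_type_omega r \<longleftrightarrow> (r, natLeq) \<in> ordIso"

end

theory Submission
  imports Defs
begin

text \<open>
  An order of type \<open>\<omega>\<close> and a convex geometry are linked by the initial segments of the order.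

  Given the order, let \<open>\<tau> B\<close> be the set of points below some element of \<open>B\<close>; it is finite because
  the order has type \<open>\<omega>\<close>. Anti-exchange is then antisymmetry of the order, and \<open>g \<in> \<tau> {a, b}\<close> says
  precisely that \<open>g \<le> max a b\<close>.

  Conversely, in a convex geometry every closed set can be enlarged to a closed set by adding a single
  point, and this point can be chosen in the closure of the set with any prescribed outside point \<open>z\<close>
  (\<open>one_point_extension\<close>). Iterating from \<open>{}\<close>, and always aiming at the first missing point of a fixed
  enumeration, lists the whole ground set in such a way that all initial segments are closed
  (\<open>closed_initial_segments\<close>): while the target stays the same, the chain remains inside one finite
  closed set, so that every target is reached. In the resulting order a midpoint \<open>g\<close> of \<open>a\<close> and \<open>b\<close> lies
  in the closed initial segment that ends at \<open>max a b\<close>.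
\<close>

section \<open>Orders of type omega as rank functions\<close>

definition rank_order :: "'a set \<Rightarrow> ('a \<Rightarrow> nat) \<Rightarrow> 'a rel" where
  "rank_order X p = {(a, b). a \<in> X \<and> b \<in> X \<and> p a \<le> p b}"

lemma Field_rank_order: "Field (rank_order X p) = X"
  by (auto simp: Field_def rank_order_def)

lemma linear_order_on_rank_order:
  assumes "inj_on p X"
  shows "linear_order_on X (rank_order X p)"
  using assms
  by (auto simp: linear_order_on_def partial_order_on_def preorder_on_def refl_on_def trans_def
      antisym_def total_on_def rank_order_def inj_on_def)

lemma order_type_omega_rank_order:
  assumes p: "bij_betw p X UNIV"
  shows "order_type_omega (rank_order X p)"
proof -
  let ?r = "rank_order X p"
  have lin: "linear_order_on X ?r"
    using p by (intro linear_order_on_rank_order) (simp add: bij_betw_def)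
  have "?r - Id \<subseteq> inv_image less_than p"
    using p by (auto simp: rank_order_def bij_betw_def inj_on_def le_less)
  then have "wf (?r - Id)"
    by (rule wf_subset[rotated]) simp
  with lin have "Well_order ?r"
    by (simp add: well_order_on_def Field_rank_order)
  moreover have "BNF_Wellorder_Embedding.iso ?r natLeq p"
    unfolding iso_iff2 Field_rank_order Field_natLeq
    using p by (simp add: rank_order_def natLeq_def)
  ultimately show ?thesis
    unfolding order_type_omega_def ordIso_def using natLeq_Well_order by blast
qed

lemma order_type_omega_obtain_rank:
  assumes "linear_order_on X r" "order_type_omega r"
  obtains p where "bij_betw p X UNIV" "r = rank_order X p"
proof -
  have sub: "r \<subseteq> X \<times> X" and F: "Field r = X"
    using assms(1)
    by (auto simp: linear_order_on_def partial_order_on_def preorder_on_def refl_on_def Field_def)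
  obtain p where "BNF_Wellorder_Embedding.iso r natLeq p"
    using assms(2) by (auto simp: order_type_omega_def ordIso_def)
  then have p: "bij_betw p X UNIV" "\<forall>a\<in>X. \<forall>b\<in>X. (a, b) \<in> r \<longleftrightarrow> p a \<le> p b"
    unfolding iso_iff2 F Field_natLeq by (simp_all add: natLeq_def)
  then have "r = rank_order X p"
    using sub by (auto simp: rank_order_def)
  with p(1) show thesis by (rule that)
qed

lemma midpointed_rank_order_iff:
  fixes G :: "('a, 'b) monoid_scheme"
  assumes "group G" "S \<subseteq> carrier G" "inj_on p (carrier G)"
  shows "midpointed_order G S (rank_order (carrier G) p) \<longleftrightarrow>
    (\<forall>g\<in>carrier G. \<forall>h\<in>S. p g \<le> max (p (g \<otimes>\<^bsub>G\<^esub> inv\<^bsub>G\<^esub> h)) (p (g \<otimes>\<^bsub>G\<^esub> h)))"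
proof -
  interpret group G by fact
  have "(g, rel_max (rank_order (carrier G) p) (g \<otimes>\<^bsub>G\<^esub> inv\<^bsub>G\<^esub> h) (g \<otimes>\<^bsub>G\<^esub> h)) \<in> rank_order (carrier G) p
      \<longleftrightarrow> p g \<le> max (p (g \<otimes>\<^bsub>G\<^esub> inv\<^bsub>G\<^esub> h)) (p (g \<otimes>\<^bsub>G\<^esub> h))"
    if "g \<in> carrier G" "h \<in> S" for g h
  proof -
    have "h \<in> carrier G" using that assms(2) by blast
    with that(1) have "g \<otimes>\<^bsub>G\<^esub> inv\<^bsub>G\<^esub> h \<in> carrier G" "g \<otimes>\<^bsub>G\<^esub> h \<in> carrier G"
      by simp_all
    with that(1) show ?thesis
      by (auto simp: rel_max_def rank_order_def max_def)
  qed
  then show ?thesis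
    using linear_order_on_rank_order[OF assms(3)] by (simp add: midpointed_order_def)
qed

section \<open>From an order to a convex geometry\<close>

definition down_closure :: "'a set \<Rightarrow> ('a \<Rightarrow> nat) \<Rightarrow> 'a set \<Rightarrow> 'a set" where
  "down_closure X p B = {a \<in> X. \<exists>b\<in>B. p a \<le> p b}"

lemma convex_geometry_closure_down_closure:
  assumes "inj_on p X"
  shows "convex_geometry_closure X (down_closure X p ` Fpow X) (down_closure X p)"
proof -
  have fin: "down_closure X p B \<in> Fpow X" if "B \<in> Fpow X" for B
  proof -
    have "finite (\<Union>b\<in>B. {..p b})"
      using that by (simp add: Fpow_def)
    moreover have "p ` down_closure X p B \<subseteq> (\<Union>b\<in>B. {..p b})"
      by (auto simp: down_closure_def)
    ultimately have "finite (p ` down_closure X p B)"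
      by (rule finite_subset[rotated])
    moreover have "down_closure X p B \<subseteq> X"
      by (auto simp: down_closure_def)
    ultimately show ?thesis
      using finite_imageD inj_on_subset[OF assms] by (auto simp: Fpow_def)
  qed
  have idem: "down_closure X p (down_closure X p B) = down_closure X p B" for B
    unfolding down_closure_def using order_trans by blast
  \<comment> \<open>As \<open>y \<notin> C\<close> and \<open>C\<close> is an initial segment, only \<open>z\<close> can put \<open>y\<close> into the closure: \<open>p y \<le> p z\<close>.
      By symmetry \<open>p z \<le> p y\<close>.\<close>
  have anti: "z \<notin> down_closure X p (C \<union> {y})"
    if "C \<in> down_closure X p ` Fpow X" "y \<in> X" "z \<in> X" "y \<noteq> z" "C \<inter> {y, z} = {}"
      "y \<in> down_closure X p (C \<union> {z})" for C y z
  proof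
    assume z: "z \<in> down_closure X p (C \<union> {y})"
    have down: "a \<in> C" if "a \<in> X" "c \<in> C" "p a \<le> p c" for a c
      using \<open>C \<in> _\<close> that idem unfolding down_closure_def by blast
    have "p y \<le> p z" "p z \<le> p y"
      using that(2,3,5,6) z down unfolding down_closure_def by blast+
    with that(2-4) inj_onD[OF assms] show False
      by (metis order_antisym)
  qed
  show ?thesis
    unfolding convex_geometry_closure_def
  proof (intro conjI)
    show "down_closure X p \<in> Fpow X \<rightarrow> Fpow X" using fin by blast
    show "\<forall>C\<in>down_closure X p ` Fpow X. \<forall>y\<in>X. \<forall>z\<in>X.
        y \<noteq> z \<and> C \<inter> {y, z} = {} \<and> y \<in> down_closure X p (C \<union> {z}) \<longrightarrow>
        z \<notin> down_closure X p (C \<union> {y})"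
      using anti by blast
  qed (use idem in \<open>auto simp: down_closure_def Fpow_def\<close>)
qed

section \<open>From a convex geometry to an order\<close>

context
  fixes X :: "'a set" and \<C> :: "'a set set" and \<tau> :: "'a set \<Rightarrow> 'a set"
  assumes geometry: "convex_geometry_closure X \<C> \<tau>"
begin

lemma closure_in_Fpow: "B \<in> Fpow X \<Longrightarrow> \<tau> B \<in> Fpow X"
  using geometry by (simp add: convex_geometry_closure_def Pi_iff)

lemma closure_empty: "\<tau> {} = {}"
  using geometry by (simp add: convex_geometry_closure_def)

lemma closure_extensive: "B \<in> Fpow X \<Longrightarrow> B \<subseteq> \<tau> B"
  using geometry by (simp add: convex_geometry_closure_def)

lemma closure_idem: "B \<in> Fpow X \<Longrightarrow> \<tau> (\<tau> B) = \<tau> B"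
  using geometry by (simp add: convex_geometry_closure_def)

lemma closure_least:
  assumes "B \<in> Fpow X" "C \<in> Fpow X" "\<tau> C = C" "B \<subseteq> C"
  shows "\<tau> B \<subseteq> C"
proof -
  have "\<forall>B\<in>Fpow X. \<forall>B'\<in>Fpow X. B \<subseteq> B' \<longrightarrow> \<tau> B \<subseteq> \<tau> B'"
    using geometry by (simp add: convex_geometry_closure_def)
  with assms(1,2,4) have "\<tau> B \<subseteq> \<tau> C" by blast
  with assms(3) show ?thesis by simp
qed

lemma anti_exchange:
  assumes "C \<in> Fpow X" "\<tau> C = C" "y \<in> X - C" "z \<in> X - C" "y \<noteq> z" "y \<in> \<tau> (insert z C)"
  shows "z \<notin> \<tau> (insert y C)"
proof -
  have "C \<in> \<C>"
    using geometry image_eqI[of C \<tau> C "Fpow X"] assms(1,2)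
    by (simp add: convex_geometry_closure_def)
  moreover have "\<forall>C\<in>\<C>. \<forall>y\<in>X. \<forall>z\<in>X.
      y \<noteq> z \<and> C \<inter> {y, z} = {} \<and> y \<in> \<tau> (C \<union> {z}) \<longrightarrow> z \<notin> \<tau> (C \<union> {y})"
    using geometry by (simp add: convex_geometry_closure_def)
  ultimately show ?thesis
    using assms(3-6) by simp
qed

text \<open>
  Choose \<open>x\<close> such that \<open>\<tau> (insert x C)\<close> is as small as possible. A further point \<open>y\<close> of this closure
  would, by anti-exchange, generate a strictly smaller one.
\<close>

lemma one_point_extension:
  assumes C: "C \<in> Fpow X" "\<tau> C = C" and z: "z \<in> X - C"
  shows "\<exists>x. x \<in> \<tau> (insert z C) \<and> x \<notin> C \<and> \<tau> (insert x C) = insert x C"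
proof -
  let ?D = "\<tau> (insert z C)"
  have insF: "insert x C \<in> Fpow X" if "x \<in> X" for x
    using C that by (auto simp: Fpow_def)
  have zF: "insert z C \<in> Fpow X" using z insF by blast
  have DF: "?D \<in> Fpow X" by (rule closure_in_Fpow[OF zF])
  have "z \<in> ?D \<and> z \<notin> C"
    using closure_extensive[OF zF] z by blast
  from ex_has_least_nat[of "\<lambda>x. x \<in> ?D \<and> x \<notin> C", OF this, of "\<lambda>x. card (\<tau> (insert x C))"]
  obtain x where x: "x \<in> ?D" "x \<notin> C"
    and min: "\<And>y. y \<in> ?D \<Longrightarrow> y \<notin> C \<Longrightarrow> card (\<tau> (insert x C)) \<le> card (\<tau> (insert y C))"
    by blast
  have xX: "x \<in> X" using x(1) DF by (auto simp: Fpow_def)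
  have E: "\<tau> (insert x C) \<in> Fpow X" "\<tau> (\<tau> (insert x C)) = \<tau> (insert x C)"
      "insert x C \<subseteq> \<tau> (insert x C)"
    using closure_in_Fpow closure_idem closure_extensive insF[OF xX] by blast+
  have ED: "\<tau> (insert x C) \<subseteq> ?D"
  proof (rule closure_least[OF insF[OF xX] DF closure_idem[OF zF]])
    show "insert x C \<subseteq> ?D" using x(1) closure_extensive[OF zF] by blast
  qed
  have "y \<in> insert x C" if y: "y \<in> \<tau> (insert x C)" for y
  proof (rule ccontr)
    assume ny: "y \<notin> insert x C"
    have yX: "y \<in> X" using y E(1) by (auto simp: Fpow_def)
    have "x \<notin> \<tau> (insert y C)"
      using anti_exchange[OF C, of y x] x xX y yX ny by blast
    moreover have "\<tau> (insert y C) \<subseteq> \<tau> (insert x C)"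
      using y E(3) by (intro closure_least[OF insF[OF yX] E(1,2)]) blast
    ultimately have "\<tau> (insert y C) \<subset> \<tau> (insert x C)"
      using E(3) by blast
    moreover have "finite (\<tau> (insert x C))" using E(1) by (simp add: Fpow_def)
    ultimately have "card (\<tau> (insert y C)) < card (\<tau> (insert x C))"
      by (simp add: psubset_card_mono)
    moreover have "card (\<tau> (insert x C)) \<le> card (\<tau> (insert y C))"
      using ED y ny by (intro min) blast+
    ultimately show False by simp
  qed
  with E(3) have "\<tau> (insert x C) = insert x C" by blast
  with x show ?thesis by blast
qed

lemma closed_initial_segments:
  assumes X: "countable X" "infinite X"
  obtains x :: "nat \<Rightarrow> 'a"
  where "bij_betw x UNIV X" "\<And>n. \<tau> (x ` {..<n}) = x ` {..<n}"
proof -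
  define e where "e = from_nat_into X"
  have e: "range e = X"
    using X by (auto simp: e_def intro!: range_from_nat_into)
  define target where "target D = e (LEAST k. e k \<notin> D)" for D
  define next_pt where "next_pt D =
    (SOME x. x \<in> \<tau> (insert (target D) D) \<and> x \<notin> D \<and> \<tau> (insert x D) = insert x D)" for D
  define C where "C = rec_nat {} (\<lambda>_ D. insert (next_pt D) D)"
  define x where "x n = next_pt (C n)" for n
  have C_0: "C 0 = {}" and C_Suc: "C (Suc n) = insert (x n) (C n)" for n
    by (simp_all add: C_def x_def)
  have target: "target D \<in> X - D" if "D \<in> Fpow X" for D
  proof -
    from that X(2) have "\<not> X \<subseteq> D" using finite_subset by (auto simp: Fpow_def)
    with e have "\<exists>k. e k \<notin> D" by blast
    then have "target D \<notin> D" unfolding target_def by (rule LeastI_ex)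
    with e show ?thesis by (auto simp: target_def)
  qed
  have next_pt: "next_pt D \<in> \<tau> (insert (target D) D) \<and> next_pt D \<notin> D \<and>
      \<tau> (insert (next_pt D) D) = insert (next_pt D) D" if "D \<in> Fpow X" "\<tau> D = D" for D
    unfolding next_pt_def using one_point_extension[OF that target[OF that(1)]] by (rule someI_ex)
  have C_inv: "C n \<in> Fpow X \<and> \<tau> (C n) = C n" for n
  proof (induction n)
    case 0
    then show ?case by (simp add: C_0 closure_empty Fpow_def)
  next
    case (Suc n)
    have "insert (target (C n)) (C n) \<in> Fpow X"
      using Suc target[of "C n"] by (auto simp: Fpow_def)
    then have "\<tau> (insert (target (C n)) (C n)) \<in> Fpow X"
      by (rule closure_in_Fpow)
    then have "x n \<in> X"
      using next_pt[of "C n"] Suc by (auto simp: x_def Fpow_def)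
    with Suc next_pt[of "C n"] show ?case
      by (auto simp: C_Suc x_def Fpow_def)
  qed
  have x: "x n \<in> \<tau> (insert (target (C n)) (C n))" "x n \<notin> C n" for n
    using next_pt[of "C n"] C_inv by (auto simp: x_def)
  have C_eq: "C n = x ` {..<n}" for n
    by (induction n) (auto simp: C_0 C_Suc lessThan_Suc)
  have inj: "inj x"
  proof (rule linorder_injI)
    fix m n :: nat
    assume "m < n"
    then have "x m \<in> C n" by (simp add: C_eq)
    with x(2)[of n] show "x m \<noteq> x n" by auto
  qed
  have sub: "range x \<subseteq> X"
  proof
    fix a
    assume "a \<in> range x"
    then obtain n where "a = x n" by blast
    then have "a \<in> C (Suc n)" by (simp add: C_Suc)
    with C_inv show "a \<in> X" by (auto simp: Fpow_def)
  qed
  have "e k \<in> range x" for k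
  proof (induction k rule: less_induct)
    case (less k)
    show ?case
    proof (rule ccontr)
      assume ek: "e k \<notin> range x"
      \<comment> \<open>From some stage \<open>N\<close> on, the target is always \<open>e k\<close>, and the chain is confined to the finite
          set \<open>\<tau> (insert (e k) (C N))\<close>.\<close>
      have "finite (e ` {..<k})" "e ` {..<k} \<subseteq> range x"
        using less by auto
      then obtain I where I: "finite I" "e ` {..<k} = x ` I"
        by (meson finite_subset_image)
      obtain N where "I \<subseteq> {..<N}"
        using I(1) by (metis finite_nat_iff_bounded)
      with I(2) have N: "e ` {..<k} \<subseteq> C N"
        by (auto simp: C_eq)
      have tgt: "target (C n) = e k" if "N \<le> n" for n
      proof -
        have "C N \<subseteq> C n" using that by (auto simp: C_eq)
        with N have "e i \<in> C n" if "i < k" for i using that by blast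
        moreover have "e k \<notin> C n" using ek by (auto simp: C_eq)
        ultimately have "(LEAST i. e i \<notin> C n) = k"
          by (intro Least_equality) (auto intro: leI)
        then show ?thesis by (simp add: target_def)
      qed
      let ?D = "\<tau> (insert (e k) (C N))"
      have ekX: "e k \<in> X" using e by blast
      have NF: "insert (e k) (C N) \<in> Fpow X"
        using C_inv[of N] ekX by (auto simp: Fpow_def)
      note D = closure_in_Fpow[OF NF] closure_idem[OF NF] closure_extensive[OF NF]
      have bound: "C n \<subseteq> ?D" if "N \<le> n" for n
        using that
      proof (induction n rule: dec_induct)
        case base
        then show ?case using D(3) by blast
      next
        case (step n)
        have "\<tau> (insert (e k) (C n)) \<subseteq> ?D"
          using C_inv[of n] ekX D step.IH by (intro closure_least) (auto simp: Fpow_def)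
        with x(1)[of n] tgt[OF step.hyps(1)] step.IH show ?case
          by (auto simp: C_Suc)
      qed
      have "range x \<subseteq> ?D"
      proof
        fix a
        assume "a \<in> range x"
        then obtain n where "a = x n" by blast
        then have "a \<in> C (N + Suc n)" by (simp add: C_eq)
        with bound[of "N + Suc n"] show "a \<in> ?D" by auto
      qed
      with D(1) have "finite (range x)"
        by (auto simp: Fpow_def intro: finite_subset)
      with inj show False
        using finite_imageD infinite_UNIV_nat by blast
    qed
  qed
  with e sub have "range x = X" by blast
  with inj have "bij_betw x UNIV X" by (simp add: bij_betw_def)
  moreover have "\<tau> (x ` {..<n}) = x ` {..<n}" for n
    using C_inv[of n] by (simp add: C_eq)
  ultimately show thesis by (rule that)
qed

lemma rank_with_closed_initial_segments:
  assumes "countable X" "infinite X"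
  obtains p :: "'a \<Rightarrow> nat" where "bij_betw p X UNIV"
    "\<And>a b c. \<lbrakk>a \<in> X; b \<in> X; c \<in> \<tau> {a, b}\<rbrakk> \<Longrightarrow> p c \<le> max (p a) (p b)"
proof -
  obtain x :: "nat \<Rightarrow> 'a" where x: "bij_betw x UNIV X"
    and closed: "\<And>n. \<tau> (x ` {..<n}) = x ` {..<n}"
    using closed_initial_segments[OF assms] by blast
  let ?p = "inv_into UNIV x"
  have inv_x: "?p (x n) = n" for n
    using x by (simp add: bij_betw_def)
  have "bij_betw ?p X UNIV"
    by (rule bij_betw_inv_into[OF x])
  moreover have "?p c \<le> max (?p a) (?p b)"
    if "a \<in> X" "b \<in> X" "c \<in> \<tau> {a, b}" for a b c
  proof -
    have "a \<in> range x" "b \<in> range x"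
      using x that by (auto simp: bij_betw_def)
    then obtain i j where ij: "a = x i" "b = x j" by blast
    let ?I = "x ` {..<Suc (max i j)}"
    have "\<tau> {a, b} \<subseteq> ?I"
    proof (rule closure_least[OF _ _ closed])
      show "?I \<in> Fpow X" using x by (auto simp: Fpow_def bij_betw_def)
      show "{a, b} \<in> Fpow X" using that by (simp add: Fpow_def)
      show "{a, b} \<subseteq> ?I" using ij by auto
    qed
    with that(3) obtain k where "c = x k" "k < Suc (max i j)" by blast
    with ij show ?thesis by (simp add: inv_x)
  qed
  ultimately show thesis by (rule that)
qed

end

section \<open>The equivalence\<close>

theorem lemma61:
  fixes G :: "('a, 'b) monoid_scheme" and S :: "'a set"
  assumes "group G"
    and "countable (carrier G)" and "infinite (carrier G)"
    and "S \<subseteq> carrier G"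
  shows "(\<exists>\<C>. midpointed_convex_geometry G S \<C>) \<longleftrightarrow>
         (\<exists>r. midpointed_order G S r \<and> order_type_omega r)"
proof
  interpret group G by fact
  have mem: "g \<otimes>\<^bsub>G\<^esub> h \<in> carrier G" "g \<otimes>\<^bsub>G\<^esub> inv\<^bsub>G\<^esub> h \<in> carrier G"
    if "g \<in> carrier G" "h \<in> S" for g h
    using that assms(4) by auto
  {
    assume "\<exists>\<C>. midpointed_convex_geometry G S \<C>"
    then obtain \<C> \<tau> where geo: "convex_geometry_closure (carrier G) \<C> \<tau>"
      and mid: "\<And>g h. g \<in> carrier G \<Longrightarrow> h \<in> S \<Longrightarrow> g \<in> \<tau> {g \<otimes>\<^bsub>G\<^esub> h, g \<otimes>\<^bsub>G\<^esub> inv\<^bsub>G\<^esub> h}"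
      unfolding midpointed_convex_geometry_def by blast
    obtain p :: "'a \<Rightarrow> nat" where p: "bij_betw p (carrier G) UNIV"
      and le: "\<And>a b c. \<lbrakk>a \<in> carrier G; b \<in> carrier G; c \<in> \<tau> {a, b}\<rbrakk> \<Longrightarrow> p c \<le> max (p a) (p b)"
      using rank_with_closed_initial_segments[OF geo assms(2,3)] by blast
    have inj: "inj_on p (carrier G)" using p by (simp add: bij_betw_def)
    have "midpointed_order G S (rank_order (carrier G) p)"
      unfolding midpointed_rank_order_iff[OF assms(1,4) inj]
      using le[OF mem mid] by (simp add: max.commute)
    with order_type_omega_rank_order[OF p]
    show "\<exists>r. midpointed_order G S r \<and> order_type_omega r" by blast
  }
  {
    assume "\<exists>r. midpointed_order G S r \<and> order_type_omega r"
    then obtain r where r: "midpointed_order G S r" "order_type_omega r" by blast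
    from r(1) have "linear_order_on (carrier G) r" by (simp add: midpointed_order_def)
    then obtain p where p: "bij_betw p (carrier G) UNIV" "r = rank_order (carrier G) p"
      using r(2) by (rule order_type_omega_obtain_rank)
    have inj: "inj_on p (carrier G)" using p by (simp add: bij_betw_def)
    have "g \<in> down_closure (carrier G) p {g \<otimes>\<^bsub>G\<^esub> h, g \<otimes>\<^bsub>G\<^esub> inv\<^bsub>G\<^esub> h}"
      if "g \<in> carrier G" "h \<in> S" for g h
      using r(1) that unfolding p(2) midpointed_rank_order_iff[OF assms(1,4) inj]
      by (auto simp: down_closure_def le_max_iff_disj)
    then show "\<exists>\<C>. midpointed_convex_geometry G S \<C>"
      using convex_geometry_closure_down_closure[OF inj]
      unfolding midpointed_convex_geometry_def by blast
  }
qed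

end
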